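(* Let $n,p$ be integers, $n\ge 1$, $p\ge 0$, let $\alpha(x,\xi)=\varepsilon+\mathrm{i}\kappa$ with constants $\varepsilon\ge 0$ and $\kappa\in\mathbb{R}$, and let $\mathcal{E}_{0(p+n)}$ be the field of angular $(p+n)$-moments of the attenuated ray transform $u_0$ of order $0$ of a function $f(x,\xi)$. Then $$\delta^n\mathcal{E}_{0(p+n)}=\sum_{j=0}^{n-1}(-1)^j\alpha^j\,(\mathcal{H}^{n-j-1}f)_p+(-1)^n\alpha^n\,\mathcal{E}_{0p},$$ where $\mathcal{H}^{n-j-1}$ is a power of the operator $\mathcal{H}$, $(\mathcal{H}^{n-j-1}f)_p$ is the angular $p$-moment of the function $\mathcal{H}^{n-j-1}f$, and $(\mathcal{H}^0f)_p=f_p$.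
   Context: $D\subset\mathbb{R}^3$ is a bounded convex domain with smooth boundary, $\mathbb{S}^2$ is the unit sphere of $\mathbb{R}^3$, and $\mathbb{S}D=\{(x,\xi): x\in D,\ \xi\in\mathbb{S}^2\}$. The function $f\in C^n(\mathbb{S}D)$ is bounded and finite with respect to $x$, i.e. it vanishes for $x$ outside some compact subset of $D$; it is extended by zero to all $x\in\mathbb{R}^3$. For constant $\alpha$, the attenuated ray transform (ART) of order $0$ of $f$ is $u_0(x,\xi)=\int_0^\infty e^{-\alpha s} f(x-s\xi,\xi)\,ds$. Its integral angular $p$-moment is the symmetric $p$-tensor field $\mathcal{E}_{0p}$ with components $$\mathcal{E}_{0p}^{i_1\ldots i_p}(x)=\int_{\mathbb{S}^2}u_0(x,\xi)\,\xi^{i_1}\cdots\xi^{i_p}\,d\lambda(\xi),\qquad p\ge 0,$$ where $\xi^i$ are the components of $\xi$ and $d\lambda$ is the angular (surface) measure on the unit sphere. The angular $p$-moment of a function $g(x,\xi)$ is the symmetric $p$-tensor field $g_p$ with components $g_p^{i_1\ldots i_p}(x)=\int_{\mathbb{S}^2}g(x,\xi)\,\xi^{i_1}\cdots\xi^{i_p}\,d\lambda(\xi)$. The operator $\mathcal{H}$ is $(\mathcal{H}\psi)(x,\xi)=\frac{d}{d\tau}\psi(x+\tau\xi,\xi)\big|_{\tau=0}=\sum_{j=1}^3\xi^j\frac{\partial\psi}{\partial x^j}(x,\xi)$. The divergence $\delta$ maps symmetric tensor fields of rank $m+1$ to symmetric tensor fields of rank $m$: $(\delta w)_{j_1\ldots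 j_m}=\sum_{q=1}^3\frac{\partial w_{j_1\ldots j_m q}}{\partial x^q}$; $\delta^n$ is its $n$-fold iteration. (Upper and lower indices are not distinguished in Cartesian coordinates.) *)

theory Defs
  imports "HOL-Analysis.Analysis"
begin

text \<open>Classes of continuously differentiable functions.\<close>

primrec Ck_on :: "nat \<Rightarrow> ('a::euclidean_space \<Rightarrow> 'b::real_normed_vector) \<Rightarrow> 'a set \<Rightarrow> bool" where
  "Ck_on 0 F U \<longleftrightarrow> continuous_on U F"
| "Ck_on (Suc k) F U \<longleftrightarrow> (\<forall>x\<in>U. F differentiable (at x)) \<and>
     (\<forall>v. Ck_on k (\<lambda>x. frechet_derivative F (at x) v) U)"

text \<open>\<open>Ck_on\<close> uses full derivatives and is meant for open sets. On an embedded submanifold such as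
  \<open>D \<times> sphere 0 1\<close>, being \<open>C\<^sup>k\<close> means having local \<open>C\<^sup>k\<close> extensions to the ambient space.\<close>

definition Ck_on_submanifold ::
    "nat \<Rightarrow> ('a::euclidean_space \<Rightarrow> 'b::real_normed_vector) \<Rightarrow> 'a set \<Rightarrow> bool" where
  "Ck_on_submanifold k f S \<longleftrightarrow>
     (\<forall>z\<in>S. \<exists>U F. open U \<and> z \<in> U \<and> Ck_on k F U \<and> (\<forall>y\<in>S \<inter> U. F y = f y))"

text \<open>Near each of its boundary points, a domain with smooth boundary is the sublevel set of a smooth
  function with nonvanishing gradient.\<close>

definition smooth_boundary :: "'a::euclidean_space set \<Rightarrow> bool" where
  "smooth_boundary D \<longleftrightarrow>
     (\<forall>x\<in>frontier D. \<exists>U (\<rho> :: 'a \<Rightarrow> real). open U \<and> x \<in> U \<and> (\<forall>k. Ck_on k \<rho> U) \<and>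
        (\<forall>y\<in>U. frechet_derivative \<rho> (at y) \<noteq> (\<lambda>v. 0)) \<and>
        D \<inter> U = {y \<in> U. \<rho> y < 0} \<and> frontier D \<inter> U = {y \<in> U. \<rho> y = 0})"

text \<open>The surface measure on the unit sphere: the area element \<open>sin \<theta> d\<theta> d\<phi>\<close> of spherical
  coordinates, transported to the sphere. The underlying space of the measure is the sphere itself, so
  values of an integrand off the sphere play no role.\<close>

definition spherical_coords :: "real \<times> real \<Rightarrow> real ^ 3" where
  "spherical_coords = (\<lambda>(\<theta>, \<phi>). vector [sin \<theta> * cos \<phi>, sin \<theta> * sin \<phi>, cos \<theta>])"

definition sphere_measure :: "(real ^ 3) measure" where
  "sphere_measure =
     distr (density lborel (\<lambda>(\<theta>, \<phi>). ennreal (sin \<theta>) * indicator ({0..pi} \<times> {0..2 * pi}) (\<theta>, \<phi>)))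
       (restrict_space borel (sphere 0 1)) spherical_coords"

text \<open>A tensor field on \<open>\<real>\<^sup>3\<close> is given by its components: \<open>w [i\<^sub>1, \<dots>, i\<^sub>m] x\<close> is the
  component of \<open>w\<close> at \<open>x\<close>. A field of rank \<open>m\<close> is meaningful on index lists of length \<open>m\<close> only.\<close>

type_synonym tensor_field = "3 list \<Rightarrow> real ^ 3 \<Rightarrow> complex"

definition angular_moment :: "nat \<Rightarrow> ((real ^ 3) \<times> (real ^ 3) \<Rightarrow> complex) \<Rightarrow> tensor_field" where
  "angular_moment p g = (\<lambda>I x. LINT \<xi>|sphere_measure. g (x, \<xi>) * complex_of_real (\<Prod>k<p. \<xi> $ (I ! k)))"

definition attenuated_ray_transform ::
    "complex \<Rightarrow> ((real ^ 3) \<times> (real ^ 3) \<Rightarrow> complex) \<Rightarrow> (real ^ 3) \<times> (real ^ 3) \<Rightarrow> complex" where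
  "attenuated_ray_transform \<alpha> f =
     (\<lambda>(x, \<xi>). LINT s:{0..}|lborel. exp (- \<alpha> * complex_of_real s) * f (x - s *\<^sub>R \<xi>, \<xi>))"

definition H_op :: "((real ^ 3) \<times> (real ^ 3) \<Rightarrow> complex) \<Rightarrow> (real ^ 3) \<times> (real ^ 3) \<Rightarrow> complex" where
  "H_op \<psi> = (\<lambda>(x, \<xi>). vector_derivative (\<lambda>\<tau>. \<psi> (x + \<tau> *\<^sub>R \<xi>, \<xi>)) (at 0))"

definition divergence :: "tensor_field \<Rightarrow> tensor_field" where
  "divergence w =
     (\<lambda>J x. \<Sum>q\<in>UNIV. vector_derivative (\<lambda>t. w (J @ [q]) (x + t *\<^sub>R axis q 1)) (at 0))"

text \<open>\<open>divergence\<close> is total; \<open>divergence_exists m w\<close> says that all partial derivatives entering the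
  rank \<open>m\<close> field \<open>divergence w\<close> exist.\<close>

definition divergence_exists :: "nat \<Rightarrow> tensor_field \<Rightarrow> bool" where
  "divergence_exists m w \<longleftrightarrow>
     (\<forall>J x q. length J = m \<longrightarrow> (\<lambda>t. w (J @ [q]) (x + t *\<^sub>R axis q 1)) differentiable (at 0))"

end

theory Submission
  imports Defs
begin

text \<open>Write \<open>u\<close> for the attenuated ray transform of \<open>f\<close>. Two facts carry the identity.

  First, the divergence of the angular \<open>(p + 1)\<close>-moment of a function is the angular \<open>p\<close>-moment of its
  image under \<open>H_op\<close>: after differentiating under the integral, the partial derivatives are contracted with the
  extra factor \<open>\<xi>\<close> of the moment (\<open>divergence_angular_moment\<close>). Iterating,
  \<open>divergence ^^ n\<close> of the \<open>(p + n)\<close>-moment of \<open>u\<close> is the \<open>p\<close>-moment of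
  \<open>(H_op ^^ n) u\<close> (\<open>divergence_power_angular_moment\<close>).

  Second, \<open>u\<close> solves the stationary transport equation \<open>H u = f - \<alpha> u\<close> in every direction
  \<open>\<xi>\<close> of the unit sphere (\<open>H_op_attenuated_ray_transform\<close>), by the fundamental theorem of calculus along the
  ray. As \<open>\<alpha>\<close> is constant, \<open>H\<^sup>k\<^sup>+\<^sup>1 u = H\<^sup>k f - \<alpha> H\<^sup>k u\<close>, and taking
  \<open>p\<close>-moments and unfolding this recursion \<open>n\<close> times gives the stated sum.

  The analytic content is regularity. Since \<open>f\<close> vanishes outside a compact \<open>K \<subseteq> D\<close>, it extends by
  zero to all of space without loss of smoothness (\<open>Ck_on_submanifold_extend_by_zero\<close>), and the ray integrals
  run over bounded intervals, uniformly for \<open>x\<close> in bounded sets. All integrals involved are thus integrals of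
  continuous functions over compact boxes. Differentiating them by the Leibniz rule shows that \<open>u\<close> inherits from
  \<open>f\<close> its \<open>n\<close> orders of differentiability in \<open>x\<close> (\<open>Ck_in_x_attenuated_ray_transform\<close>), so that all
  \<open>n\<close> divergences exist.\<close>

section \<open>Functions differentiable in the space variable\<close>

abbreviation phase_space :: "((real ^ 3) \<times> (real ^ 3)) set" where
  "phase_space \<equiv> UNIV \<times> sphere 0 1"

text \<open>The divergence and \<open>H_op\<close> differentiate along straight lines in \<open>x\<close> while the direction \<open>\<xi>\<close> is
  frozen, so the gradient is recorded through its directional derivatives. Both \<open>x\<close> and the direction of
  differentiation \<open>v\<close> are arbitrary, but \<open>\<xi>\<close> stays on the sphere, where the data of the problem live.\<close>

definition has_x_gradient ::
    "((real ^ 3) \<times> (real ^ 3) \<Rightarrow> complex) \<Rightarrow> (3 \<Rightarrow> (real ^ 3) \<times> (real ^ 3) \<Rightarrow> complex) \<Rightarrow> bool" where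
  "has_x_gradient g g' \<longleftrightarrow> (\<forall>x. \<forall>\<xi>\<in>sphere 0 1. \<forall>v.
     ((\<lambda>t. g (x + t *\<^sub>R v, \<xi>)) has_vector_derivative (\<Sum>q\<in>UNIV. v $ q *\<^sub>R g' q (x, \<xi>))) (at 0))"

text \<open>Regularity in \<open>x\<close> with joint continuity in \<open>(x, \<xi>)\<close> at every order. This class is tailored to
  the two operations at hand: it is stable under multiplication by continuous functions of \<open>\<xi>\<close>, hence
  under \<open>H_op\<close> at the cost of one order, and joint continuity is what lets derivatives pass under the
  integrals over the ray and over the sphere.\<close>

primrec Ck_in_x :: "nat \<Rightarrow> ((real ^ 3) \<times> (real ^ 3) \<Rightarrow> complex) \<Rightarrow> bool" where
  "Ck_in_x 0 g \<longleftrightarrow> continuous_on phase_space g"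
| "Ck_in_x (Suc k) g \<longleftrightarrow> continuous_on phase_space g \<and>
     (\<exists>g'. has_x_gradient g g' \<and> (\<forall>q. Ck_in_x k (g' q)))"

definition x_supported :: "(real ^ 3) set \<Rightarrow> ((real ^ 3) \<times> (real ^ 3) \<Rightarrow> complex) \<Rightarrow> bool" where
  "x_supported K g \<longleftrightarrow> (\<forall>x \<xi>. x \<notin> K \<longrightarrow> \<xi> \<in> sphere 0 1 \<longrightarrow> g (x, \<xi>) = 0)"

lemma Ck_in_x_continuous: "Ck_in_x k g \<Longrightarrow> continuous_on phase_space g"
  by (cases k) auto

lemma Ck_in_x_mono: "Ck_in_x k g \<Longrightarrow> j \<le> k \<Longrightarrow> Ck_in_x j g"
proof (induction k arbitrary: g j)
  case (Suc k)
  show ?case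
  proof (cases j)
    case 0
    then show ?thesis using Suc.prems by simp
  next
    case (Suc i)
    then show ?thesis using Suc.prems Suc.IH[of _ i] by auto
  qed
qed simp

text \<open>A line through \<open>x\<close> is also a line through each of its other points, so a derivative at parameter
  \<open>0\<close> for all base points is a derivative at every parameter.\<close>

lemma has_x_gradient_line:
  assumes "has_x_gradient g g'" and "\<xi> \<in> sphere 0 1"
  shows "((\<lambda>t. g (x + t *\<^sub>R v, \<xi>)) has_vector_derivative
            (\<Sum>q\<in>UNIV. v $ q *\<^sub>R g' q (x + s *\<^sub>R v, \<xi>))) (at s)"
proof -
  have "((\<lambda>t. g ((x + s *\<^sub>R v) + t *\<^sub>R v, \<xi>)) has_vector_derivative
            (\<Sum>q\<in>UNIV. v $ q *\<^sub>R g' q (x + s *\<^sub>R v, \<xi>))) (at (s - s))"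
    using assms by (auto simp: has_x_gradient_def)
  moreover have "((\<lambda>t. t - s) has_vector_derivative 1) (at s)"
    by (auto intro!: derivative_eq_intros)
  ultimately have "((\<lambda>t. g ((x + s *\<^sub>R v) + t *\<^sub>R v, \<xi>)) \<circ> (\<lambda>t. t - s) has_vector_derivative
            1 *\<^sub>R (\<Sum>q\<in>UNIV. v $ q *\<^sub>R g' q (x + s *\<^sub>R v, \<xi>))) (at s)"
    by (intro vector_diff_chain_at)
  moreover have "(x + s *\<^sub>R v) + (t - s) *\<^sub>R v = x + t *\<^sub>R v" for t
    by (simp add: scaleR_left_diff_distrib)
  ultimately show ?thesis
    by (simp only: o_def scaleR_one)
qed

lemma Ck_in_x_linear:
  assumes "Ck_in_x k g" and "Ck_in_x k h" and "continuous_on (sphere 0 1) a" and "continuous_on (sphere 0 1) b"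
  shows "Ck_in_x k (\<lambda>z. a (snd z) * g z + b (snd z) * h z)"
proof -
  have *: "continuous_on phase_space (\<lambda>z. c (snd z))" if "continuous_on (sphere 0 1) c" for c :: "real ^ 3 \<Rightarrow> complex"
    by (rule continuous_on_compose2[OF that]) (auto intro: continuous_intros)
  show ?thesis
    using assms(1,2)
  proof (induction k arbitrary: g h)
    case 0
    show ?case using 0 by (auto intro!: continuous_intros * assms)
  next
    case (Suc k)
    obtain g' h' where g': "has_x_gradient g g'" "\<And>q. Ck_in_x k (g' q)"
      and h': "has_x_gradient h h'" "\<And>q. Ck_in_x k (h' q)"
      using Suc.prems by auto
    have "has_x_gradient (\<lambda>z. a (snd z) * g z + b (snd z) * h z)
            (\<lambda>q z. a (snd z) * g' q z + b (snd z) * h' q z)"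
      unfolding has_x_gradient_def
    proof (intro allI ballI)
      fix x v \<xi> :: "real ^ 3" assume "\<xi> \<in> sphere 0 1"
      then have "((\<lambda>t. g (x + t *\<^sub>R v, \<xi>)) has_vector_derivative (\<Sum>q\<in>UNIV. v $ q *\<^sub>R g' q (x, \<xi>))) (at 0)"
        "((\<lambda>t. h (x + t *\<^sub>R v, \<xi>)) has_vector_derivative (\<Sum>q\<in>UNIV. v $ q *\<^sub>R h' q (x, \<xi>))) (at 0)"
        using g' h' by (auto simp: has_x_gradient_def)
      then have "((\<lambda>t. a \<xi> * g (x + t *\<^sub>R v, \<xi>) + b \<xi> * h (x + t *\<^sub>R v, \<xi>)) has_vector_derivative
         a \<xi> * (\<Sum>q\<in>UNIV. v $ q *\<^sub>R g' q (x, \<xi>)) + b \<xi> * (\<Sum>q\<in>UNIV. v $ q *\<^sub>R h' q (x, \<xi>))) (at 0)"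
        by (intro derivative_intros)
      then show "((\<lambda>t. a (snd (x + t *\<^sub>R v, \<xi>)) * g (x + t *\<^sub>R v, \<xi>) + b (snd (x + t *\<^sub>R v, \<xi>)) * h (x + t *\<^sub>R v, \<xi>))
         has_vector_derivative (\<Sum>q\<in>UNIV. v $ q *\<^sub>R (a (snd (x, \<xi>)) * g' q (x, \<xi>) + b (snd (x, \<xi>)) * h' q (x, \<xi>)))) (at 0)"
        by (simp add: sum_distrib_left sum.distrib scaleR_add_right)
    qed
    moreover have "Ck_in_x k (\<lambda>z. a (snd z) * g' q z + b (snd z) * h' q z)" for q
      using g' h' by (intro Suc.IH) auto
    ultimately show ?case
      using Ck_in_x_continuous[OF Suc.prems(1)] Ck_in_x_continuous[OF Suc.prems(2)] 
      by (auto intro!: continuous_on_add continuous_on_mult * assms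
          exI[of _ "\<lambda>q z. a (snd z) * g' q z + b (snd z) * h' q z"])
  qed
qed

lemma Ck_in_x_cong:
  assumes "\<And>x \<xi>. \<xi> \<in> sphere 0 1 \<Longrightarrow> g (x, \<xi>) = h (x, \<xi>)"
  shows "Ck_in_x k g = Ck_in_x k h"
proof -
  have "continuous_on phase_space g = continuous_on phase_space h"
    using assms by (intro continuous_on_cong) auto
  moreover have "has_x_gradient g = has_x_gradient h"
    using assms by (intro ext) (auto simp: has_x_gradient_def)
  ultimately show ?thesis by (cases k) auto
qed

lemma H_op_eq_gradient:
  assumes "has_x_gradient g g'" and "\<xi> \<in> sphere 0 1"
  shows "H_op g (x, \<xi>) = (\<Sum>q\<in>UNIV. \<xi> $ q *\<^sub>R g' q (x, \<xi>))"
  using assms by (auto simp: H_op_def has_x_gradient_def intro!: vector_derivative_at)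

lemma H_op_cong:
  assumes "\<And>x. g (x, \<xi>) = h (x, \<xi>)"
  shows "H_op g (x, \<xi>) = H_op h (x, \<xi>)"
  using assms by (simp add: H_op_def)

text \<open>\<open>H_op\<close> contracts the gradient with \<open>\<xi>\<close>, and the coefficients \<open>\<xi> $ q\<close> do not depend on \<open>x\<close>:
  only the derivative itself costs an order.\<close>

lemma Ck_in_x_H_op:
  assumes "Ck_in_x (Suc k) g"
  shows "Ck_in_x k (H_op g)"
proof -
  obtain g' where g': "has_x_gradient g g'" "\<And>q. Ck_in_x k (g' q)"
    using assms by auto
  have c: "continuous_on (sphere 0 1) (\<lambda>\<xi>::real^3. complex_of_real (\<xi> $ q))" for q
    by (intro continuous_intros)
  have "Ck_in_x k (\<lambda>z. 1 * (of_real (snd z $ 1) * g' 1 z + of_real (snd z $ 2) * g' 2 z) +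
          of_real (snd z $ 3) * g' 3 z)"
    by (intro Ck_in_x_linear[where a="\<lambda>_. 1"] Ck_in_x_linear[OF g'(2) g'(2) c c] g'(2) c continuous_on_const)
  moreover have "H_op g (x, \<xi>) = 1 * (of_real (\<xi> $ 1) * g' 1 (x, \<xi>) + of_real (\<xi> $ 2) * g' 2 (x, \<xi>)) +
          of_real (\<xi> $ 3) * g' 3 (x, \<xi>)" if "\<xi> \<in> sphere 0 1" for x \<xi>
    using that by (simp add: H_op_eq_gradient[OF g'(1)] sum_3 scaleR_conv_of_real)
  ultimately show ?thesis
    by (subst Ck_in_x_cong) auto
qed

lemma Ck_in_x_H_op_power: "Ck_in_x (j + k) g \<Longrightarrow> Ck_in_x k ((H_op ^^ j) g)"
proof (induction j arbitrary: k)
  case (Suc j)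
  then have "Ck_in_x (Suc k) ((H_op ^^ j) g)"
    by (intro Suc.IH) simp
  from Ck_in_x_H_op[OF this] show ?case by simp
qed simp

section \<open>From smoothness on the sphere bundle to regularity in space\<close>

lemma Ck_on_continuous: "Ck_on k F U \<Longrightarrow> continuous_on U F"
  by (cases k) (auto intro!: continuous_at_imp_continuous_on differentiable_imp_continuous_within)

lemma Ck_on_submanifold_continuous:
  assumes "Ck_on_submanifold k f S"
  shows "continuous_on S f"
  unfolding continuous_on_eq_continuous_within
proof
  fix z assume "z \<in> S"
  then obtain U F where U: "open U" "z \<in> U" "Ck_on k F U" "\<And>y. y \<in> S \<inter> U \<Longrightarrow> F y = f y"
    using assms unfolding Ck_on_submanifold_def by metis
  have "continuous_on (S \<inter> U) f"
    using Ck_on_continuous[OF U(3)] U(4) by (metis continuous_on_cong continuous_on_subset inf_le2)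
  then have "continuous (at z within S \<inter> U) f"
    using \<open>z \<in> S\<close> U(2) by (simp add: continuous_on_eq_continuous_within)
  moreover have "at z within S \<inter> U = at z within S"
    by (rule at_within_nhd[OF U(2,1)]) auto
  ultimately show "continuous (at z within S) f" by simp
qed

lemma sum_axis_scaleR: "(\<Sum>r\<in>UNIV. axis q (1::real) $ r *\<^sub>R h r) = (h q :: complex)"
proof -
  have "(\<Sum>r\<in>UNIV. axis q (1::real) $ r *\<^sub>R h r) = (\<Sum>r\<in>UNIV. if r = q then h r else 0)"
    by (intro sum.cong) (auto simp: axis_def)
  then show ?thesis by simp
qed

text \<open>A function that vanishes on the open set \<open>- K\<close> has vanishing derivatives there; this keeps one and the
  same \<open>K\<close> available for all derivatives of \<open>f\<close>.\<close>

lemma x_supported_gradient: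
  assumes "x_supported K g" and "closed K" and "has_x_gradient g g'"
  shows "x_supported K (g' q)"
  unfolding x_supported_def
proof (intro allI impI)
  fix x \<xi> :: "real ^ 3" assume x: "x \<notin> K" and \<xi>: "\<xi> \<in> sphere 0 1"
  have "((\<lambda>t. g (x + t *\<^sub>R axis q 1, \<xi>)) has_vector_derivative
      (\<Sum>r\<in>UNIV. axis q 1 $ r *\<^sub>R g' r (x, \<xi>))) (at 0)"
    using assms(3) \<xi> unfolding has_x_gradient_def by blast
  then have 1: "((\<lambda>t. g (x + t *\<^sub>R axis q 1, \<xi>)) has_vector_derivative g' q (x, \<xi>)) (at 0)"
    by (simp only: sum_axis_scaleR)
  have "open ((\<lambda>t::real. x + t *\<^sub>R axis q 1) -` (- K))"
    using assms(2) by (intro open_vimage continuous_intros) auto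
  from has_vector_derivative_transform_within_open[OF 1 this, of "\<lambda>_. 0"]
  have "((\<lambda>_. 0) has_vector_derivative g' q (x, \<xi>)) (at (0::real))"
    using x \<xi> assms(1) by (auto simp: x_supported_def)
  then show "g' q (x, \<xi>) = 0"
    using vector_derivative_unique_at has_vector_derivative_const by blast
qed

text \<open>The \<open>x\<close>-directions are tangent to the product with the sphere, so along them every local ambient extension
  \<open>F\<close> has the derivatives of \<open>f\<close> itself. The partial derivatives of \<open>f\<close> are therefore well defined
  independently of \<open>F\<close>, and the partial derivatives of \<open>F\<close> are local extensions of them, one class less regular.\<close>

lemma Ck_on_submanifold_imp_Ck_in_x:
  assumes "Ck_on_submanifold k f phase_space"
  shows "Ck_in_x k f"
  using assms
proof (induction k arbitrary: f)
  case 0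
  then show ?case by (simp add: Ck_on_submanifold_continuous)
next
  case (Suc k)
  define f' where "f' q = (\<lambda>(x, \<xi>). vector_derivative (\<lambda>t. f (x + t *\<^sub>R axis q 1, \<xi>)) (at 0))" for q
  \<comment> \<open>An ambient extension near \<open>(x, \<xi>)\<close> computes all derivatives of \<open>f\<close> in the spatial directions
      \<open>(v, 0)\<close>, since the curves \<open>t \<mapsto> (y + t v, \<eta>)\<close> never leave \<open>phase_space\<close>.\<close>
  have ext: "\<exists>U F. open U \<and> (x, \<xi>) \<in> U \<and> Ck_on (Suc k) F U \<and>
      (\<forall>y\<in>phase_space \<inter> U. F y = f y \<and> (\<forall>q. f' q y = frechet_derivative F (at y) (axis q 1, 0))
        \<and> (\<forall>v. ((\<lambda>t. f (fst y + t *\<^sub>R v, snd y)) has_vector_derivative frechet_derivative F (at y) (v, 0)) (at 0)))"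
    if \<xi>: "\<xi> \<in> sphere 0 1" for x \<xi>
  proof -
    obtain U F where U: "open U" "(x, \<xi>) \<in> U" "Ck_on (Suc k) F U" "\<And>y. y \<in> phase_space \<inter> U \<Longrightarrow> F y = f y"
      using Suc.prems \<xi> unfolding Ck_on_submanifold_def by (metis UNIV_I mem_Sigma_iff)
    have deriv: "((\<lambda>t. f (y + t *\<^sub>R v, \<eta>)) has_vector_derivative frechet_derivative F (at (y, \<eta>)) (v, 0)) (at 0)"
      if y: "(y, \<eta>) \<in> phase_space \<inter> U" for y \<eta> v
    proof -
      have "F differentiable (at (y, \<eta>))" using U(3) y by auto
      then have "(F has_derivative frechet_derivative F (at (y, \<eta>))) (at (y, \<eta>))"
        by (simp add: frechet_derivative_works)
      then have F: "(F has_derivative frechet_derivative F (at (y, \<eta>))) (at (y + 0 *\<^sub>R v, \<eta>) )"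
        by simp
      have "((\<lambda>t::real. (y + t *\<^sub>R v, \<eta>)) has_derivative (\<lambda>t. (t *\<^sub>R v, 0))) (at 0)"
        by (auto intro!: derivative_eq_intros)
      from has_derivative_compose[OF this F]
      have "((\<lambda>t. F (y + t *\<^sub>R v, \<eta>)) has_derivative (\<lambda>t. frechet_derivative F (at (y, \<eta>)) (t *\<^sub>R (v, 0)))) (at 0)"
        by simp
      moreover have "linear (frechet_derivative F (at (y, \<eta>)))"
        using F has_derivative_linear by blast
      ultimately have "((\<lambda>t. F (y + t *\<^sub>R v, \<eta>)) has_vector_derivative frechet_derivative F (at (y, \<eta>)) (v, 0)) (at 0)"
        unfolding has_vector_derivative_def by (simp only: linear_scale)
      moreover have "open ((\<lambda>t::real. (y + t *\<^sub>R v, \<eta>)) -` U)"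
        by (intro open_vimage continuous_intros U)
      ultimately show ?thesis
        by (rule has_vector_derivative_transform_within_open) (use y U(4) in auto)
    qed
    show ?thesis
    proof (intro exI[of _ U] exI[of _ F] conjI ballI allI)
      fix y q assume "y \<in> phase_space \<inter> U"
      then show "f' q y = frechet_derivative F (at y) (axis q 1, 0)"
        by (cases y) (auto simp: f'_def intro!: vector_derivative_at deriv)
    next
      fix y v assume "y \<in> phase_space \<inter> U"
      then show "((\<lambda>t. f (fst y + t *\<^sub>R v, snd y)) has_vector_derivative frechet_derivative F (at y) (v, 0)) (at 0)"
        using deriv[of "fst y" "snd y"] by simp
    qed (use U in auto)
  qed
  have "Ck_on_submanifold k (f' q) phase_space" for q
    unfolding Ck_on_submanifold_def
  proof
    fix z assume "z \<in> phase_space"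
    then obtain U F where "open U" "z \<in> U" "Ck_on (Suc k) F U"
       "\<forall>y\<in>phase_space \<inter> U. f' q y = frechet_derivative F (at y) (axis q 1, 0)"
      using ext[of "snd z" "fst z"] by fastforce
    then show "\<exists>U F. open U \<and> z \<in> U \<and> Ck_on k F U \<and> (\<forall>y\<in>phase_space \<inter> U. F y = f' q y)"
      by (intro exI[of _ U] exI[of _ "\<lambda>y. frechet_derivative F (at y) (axis q 1, 0)"]) auto
  qed
  moreover have "has_x_gradient f f'"
    unfolding has_x_gradient_def
  proof (intro allI ballI)
    fix x v \<xi> :: "real ^ 3" assume "\<xi> \<in> sphere 0 1"
    then have z: "(x, \<xi>) \<in> phase_space" by simp
    obtain U F where U: "(x, \<xi>) \<in> U" "Ck_on (Suc k) F U"
       and *: "\<forall>y\<in>phase_space \<inter> U. F y = f y \<and> (\<forall>q. f' q y = frechet_derivative F (at y) (axis q 1, 0))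
        \<and> (\<forall>v. ((\<lambda>t. f (fst y + t *\<^sub>R v, snd y)) has_vector_derivative frechet_derivative F (at y) (v, 0)) (at 0))"
      using ext[OF \<open>\<xi> \<in> sphere 0 1\<close>, of x] by (elim exE conjE)
    have f': "f' q (x, \<xi>) = frechet_derivative F (at (x, \<xi>)) (axis q 1, 0)" for q
      using bspec[OF *, of "(x, \<xi>)"] z U(1) by simp
    have D: "((\<lambda>t. f (x + t *\<^sub>R v, \<xi>)) has_vector_derivative frechet_derivative F (at (x, \<xi>)) (v, 0)) (at 0)"
      using bspec[OF *, of "(x, \<xi>)"] z U(1) by simp
    have lin: "linear (frechet_derivative F (at (x, \<xi>)))"
      using U by (auto intro!: linear_frechet_derivative)
    have "(v, 0 :: real ^ 3) = (\<Sum>q\<in>UNIV. v $ q *\<^sub>R (axis q 1, 0))"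
      by (simp add: prod_eq_iff fst_sum snd_sum vec_eq_iff axis_def sum.delta' if_distrib cong: if_cong)
    then have "frechet_derivative F (at (x, \<xi>)) (v, 0) = (\<Sum>q\<in>UNIV. v $ q *\<^sub>R f' q (x, \<xi>))"
      using lin by (simp add: linear_sum linear_scale f' del: scaleR_Pair)
    then show "((\<lambda>t. f (x + t *\<^sub>R v, \<xi>)) has_vector_derivative (\<Sum>q\<in>UNIV. v $ q *\<^sub>R f' q (x, \<xi>))) (at 0)"
      using D by simp
  qed
  ultimately show ?case
    using Suc.IH Ck_on_submanifold_continuous[OF Suc.prems] by auto
qed

lemma Ck_on_zero: "Ck_on k (\<lambda>_. 0) U"
  by (induction k) (auto simp: frechet_derivative_const)

lemma Ck_on_subset: "Ck_on k F U \<Longrightarrow> V \<subseteq> U \<Longrightarrow> Ck_on k F V"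
  by (induction k arbitrary: F) (auto intro: continuous_on_subset)

text \<open>Every point lies over \<open>D\<close>, where \<open>f\<close> has extensions by hypothesis, or over the open complement of
  \<open>K\<close>, where the zero function is one.\<close>

lemma Ck_on_submanifold_extend_by_zero:
  assumes "open D" and "Ck_on_submanifold k f (D \<times> sphere 0 1)" and "closed K" and "K \<subseteq> D" and "x_supported K f"
  shows "Ck_on_submanifold k f phase_space"
  unfolding Ck_on_submanifold_def
proof
  fix z :: "(real ^ 3) \<times> (real ^ 3)" assume z: "z \<in> phase_space"
  show "\<exists>U F. open U \<and> z \<in> U \<and> Ck_on k F U \<and> (\<forall>y\<in>phase_space \<inter> U. F y = f y)"
  proof (cases "fst z \<in> K")
    case False
    then show ?thesis
      using assms z
      by (intro exI[of _ "(- K) \<times> UNIV"] exI[of _ "\<lambda>_. 0"])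
        (auto simp: Ck_on_zero x_supported_def intro!: open_Times)
  next
    case True
    then have "z \<in> D \<times> sphere 0 1"
      using assms(4) z by (cases z) auto
    then obtain U F where U: "open U" "z \<in> U" "Ck_on k F U"
      "\<forall>y\<in>(D \<times> sphere 0 1) \<inter> U. F y = f y"
      using assms(2) unfolding Ck_on_submanifold_def by meson
    have "open (U \<inter> D \<times> UNIV)"
      using U(1) \<open>open D\<close> by (intro open_Int open_Times) auto
    moreover have "Ck_on k F (U \<inter> D \<times> UNIV)"
      using U(3) by (rule Ck_on_subset) auto
    ultimately show ?thesis
      using U True assms(4) z by (intro exI[of _ "U \<inter> D \<times> UNIV"] exI[of _ F]) (cases z; auto)
  qed
qed

section \<open>Angular moments and their divergence\<close>

lemma spherical_coords_eq:
  "spherical_coords t = (sin (fst t) * cos (snd t)) *\<^sub>R axis 1 1 + (sin (fst t) * sin (snd t)) *\<^sub>R axis 2 1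
     + cos (fst t) *\<^sub>R axis 3 1"
  by (cases t) (simp add: spherical_coords_def vec_eq_iff forall_3 axis_def)

lemma continuous_on_spherical_coords [continuous_intros]:
  fixes A :: "'a::t2_space set"
  shows "continuous_on A f \<Longrightarrow> continuous_on A (\<lambda>y. spherical_coords (f y))"
  unfolding spherical_coords_eq by (intro continuous_intros)

lemma spherical_coords_in_sphere: "spherical_coords t \<in> sphere 0 1"
proof -
  obtain a b where t: "t = (a, b)" by force
  have "(norm (spherical_coords t))\<^sup>2 = (sin a * cos b)\<^sup>2 + (sin a * sin b)\<^sup>2 + (cos a)\<^sup>2"
    by (simp only: power2_norm_eq_inner) (simp add: t inner_vec_def sum_3 spherical_coords_def power2_eq_square)
  also have "\<dots> = (sin a)\<^sup>2 * ((cos b)\<^sup>2 + (sin b)\<^sup>2) + (cos a)\<^sup>2"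
    by (simp only: power_mult_distrib distrib_left)
  also have "\<dots> = 1" by simp
  finally show ?thesis
    by (simp add: power2_eq_1_iff) (smt (verit) norm_ge_zero)
qed

text \<open>Spherical coordinates turn a surface integral into an integral over a compact rectangle, which makes the
  Leibniz rule for parameter integrals over boxes applicable. The density \<open>sin \<theta>\<close> is nonnegative
  because the polar angle is restricted to \<open>{0..pi}\<close>.\<close>

lemma
  fixes h :: "real ^ 3 \<Rightarrow> complex"
  assumes h: "continuous_on (sphere 0 1) h"
  shows integrable_sphere_measure: "integrable sphere_measure h"
    and integral_sphere_measure: "(LINT \<xi>|sphere_measure. h \<xi>) =
          integral (cbox (0, 0) (pi, 2 * pi)) (\<lambda>t. sin (fst t) *\<^sub>R h (spherical_coords t))"
proof -
  let ?B = "cbox (0, 0) (pi, 2 * pi) :: (real \<times> real) set"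
  let ?w = "\<lambda>t::real \<times> real. indicator ?B t * sin (fst t)"
  let ?S = "restrict_space borel (sphere 0 1) :: (real ^ 3) measure"
  have nonneg: "0 \<le> ?w t" for t
    by (auto simp: cbox_Pair_eq indicator_def sin_ge_zero)
  have "(\<lambda>(\<theta>, \<phi>). ennreal (sin \<theta>) * indicator ({0..pi} \<times> {0..2 * pi}) (\<theta>, \<phi>)) = (\<lambda>t. ennreal (?w t))"
    by (auto simp: cbox_Pair_eq indicator_def fun_eq_iff)
  then have sm: "sphere_measure = distr (density lborel (\<lambda>t. ennreal (?w t))) ?S spherical_coords"
    by (simp add: sphere_measure_def)
  have w: "?w \<in> borel_measurable lborel"
    by (intro borel_measurable_times borel_measurable_indicator)
      (auto intro!: borel_measurable_continuous_onI continuous_intros)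
  have sc: "spherical_coords \<in> lborel \<rightarrow>\<^sub>M ?S"
    using spherical_coords_in_sphere
    by (intro measurable_restrict_space2) (auto intro!: borel_measurable_continuous_onI continuous_intros)
  then have sc': "spherical_coords \<in> density lborel (\<lambda>t. ennreal (?w t)) \<rightarrow>\<^sub>M ?S"
    by simp
  have hm: "h \<in> borel_measurable ?S"
    using h by (rule borel_measurable_continuous_on_restrict)
  have hsc: "(\<lambda>t. h (spherical_coords t)) \<in> borel_measurable lborel"
    using measurable_compose[OF sc hm] .
  have "continuous_on UNIV (\<lambda>t. h (spherical_coords t))"
    using spherical_coords_in_sphere by (intro continuous_on_compose2[OF h] continuous_intros) auto
  then have int: "set_integrable lborel ?B (\<lambda>t. sin (fst t) *\<^sub>R h (spherical_coords t))"
    unfolding set_integrable_def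
    by (intro borel_integrable_compact compact_cbox continuous_intros) (auto intro: continuous_on_subset)
  then show "integrable sphere_measure h"
    unfolding sm integrable_distr_eq[OF sc' hm]
    by (subst integrable_density[OF hsc w]) (use nonneg in \<open>auto simp: set_integrable_def\<close>)
  have "(LINT \<xi>|sphere_measure. h \<xi>) = (LINT t : ?B | lborel. sin (fst t) *\<^sub>R h (spherical_coords t))"
    unfolding sm integral_distr[OF sc' hm]
    by (subst integral_density[OF hsc w]) (use nonneg in \<open>auto simp: set_lebesgue_integral_def\<close>)
  then show "(LINT \<xi>|sphere_measure. h \<xi>) =
          integral ?B (\<lambda>t. sin (fst t) *\<^sub>R h (spherical_coords t))"
    by (simp only: set_borel_integral_eq_integral(2)[OF int])
qed

lemma space_sphere_measure: "space sphere_measure = sphere 0 1"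
  by (simp add: sphere_measure_def space_restrict_space)

lemma continuous_on_phase_compose:
  assumes "continuous_on phase_space g" and "continuous_on A a" and "continuous_on A b"
    and "\<And>y. y \<in> A \<Longrightarrow> b y \<in> sphere 0 1"
  shows "continuous_on A (\<lambda>y. g (a y, b y))"
  using assms by (intro continuous_on_compose2[OF assms(1)] continuous_intros) auto

lemma continuous_on_moment_integrand:
  assumes "continuous_on phase_space g"
  shows "continuous_on (sphere 0 1) (\<lambda>\<xi>. g (x, \<xi>) * complex_of_real (\<Prod>k<p. \<xi> $ (I ! k)))"
  by (intro continuous_intros continuous_on_phase_compose[OF assms]) auto

text \<open>Differentiation under the integral: the monomial in \<open>\<xi>\<close> does not depend on \<open>x\<close>, and the
  \<open>x\<close>-derivative of the integrand is continuous jointly in \<open>x\<close> and the spherical coordinates.\<close>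

lemma has_vector_derivative_angular_moment:
  assumes g: "continuous_on phase_space g" and g': "\<And>q. continuous_on phase_space (g' q)"
    and grad: "has_x_gradient g g'"
  shows "((\<lambda>t. angular_moment p g I (x + t *\<^sub>R v)) has_vector_derivative
           (\<Sum>q\<in>UNIV. v $ q *\<^sub>R angular_moment p (g' q) I x)) (at 0)"
proof -
  let ?B = "cbox (0, 0) (pi, 2 * pi) :: (real \<times> real) set"
  let ?sc = spherical_coords
  define m where "m \<xi> = complex_of_real (\<Prod>k<p. \<xi> $ (I ! k))" for \<xi> :: "real ^ 3"
  have m: "continuous_on A (\<lambda>y. m (b y))" if "continuous_on A b" for A :: "'z::topological_space set" and b
    unfolding m_def by (intro continuous_intros that)
  have moment: "angular_moment p h I y = integral ?B (\<lambda>t. sin (fst t) *\<^sub>R (h (y, ?sc t) * m (?sc t)))"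
    if "continuous_on phase_space h" for h y
    unfolding angular_moment_def m_def
    by (rule integral_sphere_measure[OF continuous_on_moment_integrand[OF that]])
  have int: "(\<lambda>t. sin (fst t) *\<^sub>R (h (y, ?sc t) * m (?sc t))) integrable_on ?B"
    if "continuous_on phase_space h" for h y
    by (intro integrable_continuous continuous_intros m continuous_on_phase_compose[OF that] spherical_coords_in_sphere)
  have "((\<lambda>t. integral ?B (\<lambda>y. sin (fst y) *\<^sub>R (g (x + t *\<^sub>R v, ?sc y) * m (?sc y)))) has_vector_derivative
         integral ?B (\<lambda>y. sin (fst y) *\<^sub>R ((\<Sum>q\<in>UNIV. v $ q *\<^sub>R g' q (x + 0 *\<^sub>R v, ?sc y)) * m (?sc y)))) (at 0)"
  proof (rule leibniz_rule_vector_derivative[where U = UNIV])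
    show "((\<lambda>t. sin (fst y) *\<^sub>R (g (x + t *\<^sub>R v, ?sc y) * m (?sc y))) has_vector_derivative
        sin (fst y) *\<^sub>R ((\<Sum>q\<in>UNIV. v $ q *\<^sub>R g' q (x + t *\<^sub>R v, ?sc y)) * m (?sc y))) (at t)" for t y
      using has_x_gradient_line[OF grad spherical_coords_in_sphere]
      by (intro bounded_linear.has_vector_derivative[OF bounded_linear_scaleR_right]
          bounded_linear.has_vector_derivative[OF bounded_linear_mult_left])
    show "(\<lambda>y. sin (fst y) *\<^sub>R (g (x + t *\<^sub>R v, ?sc y) * m (?sc y))) integrable_on ?B" for t
      by (rule int[OF g])
    show "continuous_on (UNIV \<times> ?B) (\<lambda>(t, y). sin (fst y) *\<^sub>R ((\<Sum>q\<in>UNIV. v $ q *\<^sub>R g' q (x + t *\<^sub>R v, ?sc y)) * m (?sc y)))"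
      unfolding case_prod_unfold
      by (intro continuous_intros m continuous_on_phase_compose[OF g'] spherical_coords_in_sphere)
  qed auto
  also have "integral ?B (\<lambda>y. sin (fst y) *\<^sub>R ((\<Sum>q\<in>UNIV. v $ q *\<^sub>R g' q (x + 0 *\<^sub>R v, ?sc y)) * m (?sc y)))
      = integral ?B (\<lambda>y. \<Sum>q\<in>UNIV. v $ q *\<^sub>R (sin (fst y) *\<^sub>R (g' q (x, ?sc y) * m (?sc y))))"
    by (simp add: sum_distrib_left scaleR_sum_right mult.commute)
  also have "\<dots> = (\<Sum>q\<in>UNIV. integral ?B (\<lambda>y. v $ q *\<^sub>R (sin (fst y) *\<^sub>R (g' q (x, ?sc y) * m (?sc y)))))"
    by (intro integral_sum integrable_cmul int[OF g']) simp
  also have "\<dots> = (\<Sum>q\<in>UNIV. v $ q *\<^sub>R angular_moment p (g' q) I x)"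
    by (simp only: integral_cmul moment[OF g'])
  finally show ?thesis
    by (simp only: moment[OF g])
qed

text \<open>The index \<open>q\<close> summed over by the divergence carries a factor \<open>\<xi> $ q\<close> in the moment. Under the integral
  this factor meets the partial derivative in direction \<open>q\<close>, and the sum of these products is \<open>H_op g\<close>.\<close>

lemma
  assumes g: "Ck_in_x 1 g" and J: "length J = p"
  shows angular_moment_differentiable:
      "(\<lambda>t. angular_moment (Suc p) g (J @ [q]) (x + t *\<^sub>R axis q 1)) differentiable (at 0)"
    and divergence_angular_moment:
      "divergence (angular_moment (Suc p) g) J x = angular_moment p (H_op g) J x"
proof -
  obtain g' where grad: "has_x_gradient g g'" and g': "\<And>q. continuous_on phase_space (g' q)"
    using g by auto
  have g: "continuous_on phase_space g" using g by simp
  have D: "((\<lambda>t. angular_moment (Suc p) g (J @ [q]) (x + t *\<^sub>R axis q 1)) has_vector_derivative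
      angular_moment (Suc p) (g' q) (J @ [q]) x) (at 0)" for q
    using has_vector_derivative_angular_moment[OF g g' grad, of "Suc p" "J @ [q]" x "axis q 1"]
    by (simp only: sum_axis_scaleR)
  then show "(\<lambda>t. angular_moment (Suc p) g (J @ [q]) (x + t *\<^sub>R axis q 1)) differentiable (at 0)"
    by (rule differentiableI_vector)
  have "divergence (angular_moment (Suc p) g) J x = (\<Sum>q\<in>UNIV. angular_moment (Suc p) (g' q) (J @ [q]) x)"
    by (simp add: divergence_def vector_derivative_at[OF D])
  also have "\<dots> = (LINT \<xi>|sphere_measure. (\<Sum>q\<in>UNIV. g' q (x, \<xi>) * complex_of_real (\<Prod>k<Suc p. \<xi> $ ((J @ [q]) ! k))))"
    unfolding angular_moment_def
    by (rule Bochner_Integration.integral_sum[symmetric])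
      (intro integrable_sphere_measure continuous_on_moment_integrand g')
  also have "\<dots> = angular_moment p (H_op g) J x"
    unfolding angular_moment_def
  proof (rule Bochner_Integration.integral_cong[OF refl])
    fix \<xi> assume "\<xi> \<in> space sphere_measure"
    then have \<xi>: "\<xi> \<in> sphere 0 1" by (simp add: space_sphere_measure)
    have "(\<Prod>k<p. \<xi> $ ((J @ [q]) ! k)) = (\<Prod>k<p. \<xi> $ (J ! k))" for q
      by (intro prod.cong) (auto simp: nth_append J)
    moreover have "(J @ [q]) ! p = q" for q
      by (simp add: nth_append J)
    ultimately show "(\<Sum>q\<in>UNIV. g' q (x, \<xi>) * complex_of_real (\<Prod>k<Suc p. \<xi> $ ((J @ [q]) ! k))) =
        H_op g (x, \<xi>) * complex_of_real (\<Prod>k<p. \<xi> $ (J ! k))"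
      by (simp add: H_op_eq_gradient[OF grad \<xi>] sum_distrib_left sum_distrib_right scaleR_conv_of_real mult_ac
          del: of_real_prod)
  qed
  finally show "divergence (angular_moment (Suc p) g) J x = angular_moment p (H_op g) J x" .
qed

text \<open>Tensor components are compared only on index lists of the proper length, since the two sides of a
  component formula need not agree on others.\<close>

lemma divergence_cong:
  assumes "\<And>I y. length I = Suc p \<Longrightarrow> w I y = w' I y" and "length J = p"
  shows "divergence w J x = divergence w' J x"
  using assms by (simp add: divergence_def)

text \<open>Each divergence lowers the rank by one and puts one more \<open>H_op\<close> inside the moment.\<close>

lemma divergence_power_angular_moment:
  assumes "Ck_in_x k g" and "length I = p"
  shows "(divergence ^^ k) (angular_moment (p + k) g) I x = angular_moment p ((H_op ^^ k) g) I x"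
  using assms
proof (induction k arbitrary: p I x)
  case (Suc k)
  have "(divergence ^^ k) (angular_moment (p + Suc k) g) J y = angular_moment (Suc p) ((H_op ^^ k) g) J y"
    if "length J = Suc p" for J y
    using Suc.IH[OF Ck_in_x_mono[OF Suc.prems(1)] that] by simp
  then have "divergence ((divergence ^^ k) (angular_moment (p + Suc k) g)) I x =
      divergence (angular_moment (Suc p) ((H_op ^^ k) g)) I x"
    by (rule divergence_cong[OF _ Suc.prems(2)])
  also have "Ck_in_x 1 ((H_op ^^ k) g)"
    using Suc.prems(1) by (intro Ck_in_x_H_op_power) simp
  note divergence_angular_moment[OF this Suc.prems(2)]
  finally show ?case by (simp only: funpow.simps o_apply)
qed simp

lemma divergence_exists_power_angular_moment:
  assumes "Ck_in_x (Suc k) g"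
  shows "divergence_exists p ((divergence ^^ k) (angular_moment (Suc p + k) g))"
  unfolding divergence_exists_def
proof (intro allI impI)
  fix J :: "3 list" and x q assume J: "length J = p"
  have "Ck_in_x k g" using assms by (rule Ck_in_x_mono) simp
  then have "(divergence ^^ k) (angular_moment (Suc p + k) g) (J @ [q]) y =
      angular_moment (Suc p) ((H_op ^^ k) g) (J @ [q]) y" for y
    by (rule divergence_power_angular_moment) (simp add: J)
  then have eq: "(\<lambda>t. (divergence ^^ k) (angular_moment (Suc p + k) g) (J @ [q]) (x + t *\<^sub>R axis q 1)) =
      (\<lambda>t. angular_moment (Suc p) ((H_op ^^ k) g) (J @ [q]) (x + t *\<^sub>R axis q 1))"
    by (intro ext)
  have "Ck_in_x 1 ((H_op ^^ k) g)"
    using assms by (intro Ck_in_x_H_op_power) simp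
  then show "(\<lambda>t. (divergence ^^ k) (angular_moment (Suc p + k) g) (J @ [q]) (x + t *\<^sub>R axis q 1))
       differentiable (at 0)"
    unfolding eq using J by (rule angular_moment_differentiable)
qed

section \<open>The attenuated ray transform\<close>

lemma x_supported_ray_exit:
  assumes "x_supported K g" and "K \<subseteq> cball 0 R" and "\<xi> \<in> sphere 0 1" and "norm x + R < s"
  shows "g (x - s *\<^sub>R \<xi>, \<xi>) = 0"
proof -
  have "norm (s *\<^sub>R \<xi>) \<le> norm (x - s *\<^sub>R \<xi>) + norm x"
    using norm_triangle_ineq4[of x "x - s *\<^sub>R \<xi>"] by simp
  then have "norm (x - s *\<^sub>R \<xi>) > R"
    using assms(3,4) by simp
  then have "x - s *\<^sub>R \<xi> \<notin> K"
    using assms(2) by auto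
  then show ?thesis
    using assms(1,3) by (simp add: x_supported_def)
qed

text \<open>The backward ray from \<open>x\<close> has left the ball around the support after length \<open>norm x + R\<close>. Any upper limit
  beyond that may be used, and a single one serves for all \<open>x\<close> in a bounded set.\<close>

lemma attenuated_ray_transform_eq_integral:
  assumes g: "continuous_on phase_space g" and K: "x_supported K g" "K \<subseteq> cball 0 R"
    and \<xi>: "\<xi> \<in> sphere 0 1" and L: "norm x + R \<le> L"
  shows "attenuated_ray_transform \<alpha> g (x, \<xi>) =
           integral {0..L} (\<lambda>s. exp (- \<alpha> * complex_of_real s) * g (x - s *\<^sub>R \<xi>, \<xi>))"
proof -
  let ?h = "\<lambda>s. exp (- \<alpha> * complex_of_real s) * g (x - s *\<^sub>R \<xi>, \<xi>)"
  have zero: "g (x - s *\<^sub>R \<xi>, \<xi>) = 0" if "s > L" for s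
    using L that by (intro x_supported_ray_exit[OF K \<xi>]) simp
  have "set_integrable lborel {0..L} ?h"
    by (intro borel_integrable_atLeastAtMost' continuous_intros continuous_on_phase_compose[OF g] \<xi>)
  then have "integral {0..L} ?h = (LINT s:{0..L}|lborel. ?h s)"
    by (simp only: set_borel_integral_eq_integral)
  also have "\<dots> = (LINT s:{0..}|lborel. ?h s)"
  proof -
    have "indicator {0..L} s *\<^sub>R ?h s = indicator {0..} s *\<^sub>R ?h s" for s
      by (cases "s > L"; cases "s \<ge> 0") (auto simp: zero indicator_def)
    then show ?thesis
      unfolding set_lebesgue_integral_def by (simp only:)
  qed
  finally show ?thesis
    by (simp add: attenuated_ray_transform_def)
qed

lemma continuous_on_attenuated_ray_transform:
  assumes g: "continuous_on phase_space g" and K: "x_supported K g" "bounded K"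
  shows "continuous_on phase_space (attenuated_ray_transform \<alpha> g)"
  unfolding continuous_on_eq_continuous_within
proof
  fix z :: "(real ^ 3) \<times> (real ^ 3)" assume z: "z \<in> phase_space"
  obtain R where R: "K \<subseteq> cball 0 R"
    using K(2) by (auto simp: bounded_iff subset_iff)
  \<comment> \<open>Continuity is local: over the unit ball around \<open>fst z\<close> one upper limit of integration works.\<close>
  let ?U = "ball (fst z) 1 \<times> sphere 0 1 :: ((real ^ 3) \<times> (real ^ 3)) set"
  define L where "L = norm (fst z) + 1 + R"
  have "continuous_on ?U (\<lambda>y. integral (cbox 0 L) (\<lambda>s. exp (- \<alpha> * complex_of_real s) * g (fst y - s *\<^sub>R snd y, snd y)))"
    by (intro integral_continuous_on_param)
      (auto simp: case_prod_unfold intro!: continuous_intros continuous_on_phase_compose[OF g])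
  moreover have "attenuated_ray_transform \<alpha> g y =
      integral (cbox 0 L) (\<lambda>s. exp (- \<alpha> * complex_of_real s) * g (fst y - s *\<^sub>R snd y, snd y))"
    if y: "y \<in> ?U" for y
  proof -
    have "norm (fst y) \<le> norm (fst z) + dist (fst z) (fst y)"
      by (metis dist_norm norm_minus_commute norm_triangle_sub)
    moreover have "dist (fst z) (fst y) < 1" using y by auto
    ultimately have "norm (fst y) + R \<le> L" by (simp add: L_def)
    then show ?thesis
      using attenuated_ray_transform_eq_integral[OF g K(1) R, of "snd y" "fst y" L \<alpha>] y by auto
  qed
  ultimately have "continuous_on ?U (attenuated_ray_transform \<alpha> g)"
    by (simp cong: continuous_on_cong)
  then have "continuous (at z within ?U) (attenuated_ray_transform \<alpha> g)"
    using z by (cases z) (simp add: continuous_on_eq_continuous_within)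
  moreover have "at z within ?U = at z within phase_space"
  proof (rule at_within_nhd[where S = "ball (fst z) 1 \<times> UNIV"])
    show "z \<in> ball (fst z) 1 \<times> UNIV" by (cases z) simp
  qed (auto intro: open_Times)
  ultimately show "continuous (at z within phase_space) (attenuated_ray_transform \<alpha> g)"
    by simp
qed

text \<open>The ray transform commutes with translations in \<open>x\<close>, hence with derivatives in \<open>x\<close>.\<close>

lemma has_x_gradient_attenuated_ray_transform:
  assumes g: "continuous_on phase_space g" and g': "\<And>q. continuous_on phase_space (g' q)"
    and grad: "has_x_gradient g g'" and K: "x_supported K g" "compact K"
  shows "has_x_gradient (attenuated_ray_transform \<alpha> g) (\<lambda>q. attenuated_ray_transform \<alpha> (g' q))"
  unfolding has_x_gradient_def
proof (intro allI ballI)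
  fix x v \<xi> :: "real ^ 3" assume \<xi>: "\<xi> \<in> sphere 0 1"
  obtain R where R: "K \<subseteq> cball 0 R"
    using compact_imp_bounded[OF K(2)] by (auto simp: bounded_iff subset_iff)
  have K': "x_supported K (g' q)" for q
    using x_supported_gradient[OF K(1) compact_imp_closed[OF K(2)] grad] .
  \<comment> \<open>An upper limit of integration valid for all points \<open>x + t v\<close> with \<open>\<bar>t\<bar> < 1\<close>.\<close>
  define L where "L = norm x + norm v + R"
  let ?e = "\<lambda>s. exp (- \<alpha> * complex_of_real s)"
  let ?U = "{-1<..<1} :: real set"
  have bound: "norm (x + t *\<^sub>R v) + R \<le> L" if "t \<in> ?U" for t
  proof -
    have "norm (x + t *\<^sub>R v) \<le> norm x + \<bar>t\<bar> * norm v"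
      using norm_triangle_ineq[of x "t *\<^sub>R v"] by simp
    also have "\<bar>t\<bar> * norm v \<le> 1 * norm v"
      using that by (intro mult_right_mono) auto
    finally show ?thesis by (simp add: L_def)
  qed
  have "((\<lambda>t. integral (cbox 0 L) (\<lambda>s. ?e s * g (x + t *\<^sub>R v - s *\<^sub>R \<xi>, \<xi>))) has_vector_derivative
         integral (cbox 0 L) (\<lambda>s. ?e s * (\<Sum>q\<in>UNIV. v $ q *\<^sub>R g' q (x + 0 *\<^sub>R v - s *\<^sub>R \<xi>, \<xi>)))) (at 0 within ?U)"
  proof (rule leibniz_rule_vector_derivative)
    fix t s :: real
    have "((\<lambda>t. g ((x - s *\<^sub>R \<xi>) + t *\<^sub>R v, \<xi>)) has_vector_derivative
        (\<Sum>q\<in>UNIV. v $ q *\<^sub>R g' q ((x - s *\<^sub>R \<xi>) + t *\<^sub>R v, \<xi>))) (at t within ?U)"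
      by (rule has_vector_derivative_at_within[OF has_x_gradient_line[OF grad \<xi>]])
    then have "((\<lambda>t. ?e s * g ((x - s *\<^sub>R \<xi>) + t *\<^sub>R v, \<xi>)) has_vector_derivative
        ?e s * (\<Sum>q\<in>UNIV. v $ q *\<^sub>R g' q ((x - s *\<^sub>R \<xi>) + t *\<^sub>R v, \<xi>))) (at t within ?U)"
      by (rule bounded_linear.has_vector_derivative[OF bounded_linear_mult_right])
    then show "((\<lambda>t. ?e s * g (x + t *\<^sub>R v - s *\<^sub>R \<xi>, \<xi>)) has_vector_derivative
        ?e s * (\<Sum>q\<in>UNIV. v $ q *\<^sub>R g' q (x + t *\<^sub>R v - s *\<^sub>R \<xi>, \<xi>))) (at t within ?U)"
      by (simp only: add_diff_eq diff_add_eq)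
  next
    show "(\<lambda>s. ?e s * g (x + t *\<^sub>R v - s *\<^sub>R \<xi>, \<xi>)) integrable_on cbox 0 L" for t
      by (intro integrable_continuous continuous_intros continuous_on_phase_compose[OF g] \<xi>)
    show "continuous_on (?U \<times> cbox 0 L) (\<lambda>(t, s). ?e s * (\<Sum>q\<in>UNIV. v $ q *\<^sub>R g' q (x + t *\<^sub>R v - s *\<^sub>R \<xi>, \<xi>)))"
      unfolding case_prod_unfold
      by (intro continuous_intros continuous_on_phase_compose[OF g'] \<xi>)
  qed auto
  also have "integral (cbox 0 L) (\<lambda>s. ?e s * (\<Sum>q\<in>UNIV. v $ q *\<^sub>R g' q (x + 0 *\<^sub>R v - s *\<^sub>R \<xi>, \<xi>)))
      = integral (cbox 0 L) (\<lambda>s. \<Sum>q\<in>UNIV. v $ q *\<^sub>R (?e s * g' q (x - s *\<^sub>R \<xi>, \<xi>)))"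
    by (simp add: sum_distrib_left)
  also have "\<dots> = (\<Sum>q\<in>UNIV. integral (cbox 0 L) (\<lambda>s. v $ q *\<^sub>R (?e s * g' q (x - s *\<^sub>R \<xi>, \<xi>))))"
    by (intro integral_sum integrable_cmul integrable_continuous continuous_intros
        continuous_on_phase_compose[OF g'] \<xi>) simp
  also have "\<dots> = (\<Sum>q\<in>UNIV. v $ q *\<^sub>R attenuated_ray_transform \<alpha> (g' q) (x, \<xi>))"
  proof -
    have "norm x + R \<le> L" by (simp add: L_def)
    from attenuated_ray_transform_eq_integral[OF g' K' R \<xi> this]
    show ?thesis by (simp only: integral_cmul cbox_interval)
  qed
  finally have "((\<lambda>t. integral (cbox 0 L) (\<lambda>s. ?e s * g (x + t *\<^sub>R v - s *\<^sub>R \<xi>, \<xi>))) has_vector_derivative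
      (\<Sum>q\<in>UNIV. v $ q *\<^sub>R attenuated_ray_transform \<alpha> (g' q) (x, \<xi>))) (at 0 within ?U)" .
  moreover have "at 0 within ?U = at (0 :: real)"
    by (rule at_within_open) auto
  ultimately show "((\<lambda>t. attenuated_ray_transform \<alpha> g (x + t *\<^sub>R v, \<xi>)) has_vector_derivative
      (\<Sum>q\<in>UNIV. v $ q *\<^sub>R attenuated_ray_transform \<alpha> (g' q) (x, \<xi>))) (at 0)"
    using attenuated_ray_transform_eq_integral[OF g K(1) R \<xi> bound, of _ \<alpha>]
    by (auto intro: has_vector_derivative_transform_within_open[of _ _ _ ?U])
qed

lemma Ck_in_x_attenuated_ray_transform:
  assumes "Ck_in_x k g" and "x_supported K g" and "compact K"
  shows "Ck_in_x k (attenuated_ray_transform \<alpha> g)"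
  using assms
proof (induction k arbitrary: g)
  case 0
  then show ?case
    by (simp add: continuous_on_attenuated_ray_transform compact_imp_bounded)
next
  case (Suc k)
  obtain g' where grad: "has_x_gradient g g'" and g': "\<And>q. Ck_in_x k (g' q)"
    using Suc.prems(1) by auto
  have "Ck_in_x k (attenuated_ray_transform \<alpha> (g' q))" for q
    by (rule Suc.IH[OF g' x_supported_gradient[OF Suc.prems(2) compact_imp_closed[OF Suc.prems(3)] grad] Suc.prems(3)])
  moreover have "has_x_gradient (attenuated_ray_transform \<alpha> g) (\<lambda>q. attenuated_ray_transform \<alpha> (g' q))"
    by (rule has_x_gradient_attenuated_ray_transform
        [OF Ck_in_x_continuous[OF Suc.prems(1)] Ck_in_x_continuous[OF g'] grad Suc.prems(2,3)])
  moreover have "continuous_on phase_space (attenuated_ray_transform \<alpha> g)"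
    by (rule continuous_on_attenuated_ray_transform
        [OF Ck_in_x_continuous[OF Suc.prems(1)] Suc.prems(2) compact_imp_bounded[OF Suc.prems(3)]])
  ultimately show ?case
    unfolding Ck_in_x.simps by blast
qed

text \<open>The transport equation \<open>H u + \<alpha> u = f\<close>, of which the ray transform is the solution that vanishes far
  upstream. Along the backward ray the function \<open>exp (- \<alpha> s) f (x - s \<xi>, \<xi>)\<close> goes from \<open>f (x, \<xi>)\<close> at
  \<open>s = 0\<close> to \<open>0\<close>; its derivative in \<open>s\<close> splits into the integrands of \<open>- \<alpha> u\<close> and \<open>- H u\<close>.\<close>

lemma H_op_attenuated_ray_transform:
  assumes g: "Ck_in_x 1 g" and K: "x_supported K g" "compact K" and \<xi>: "\<xi> \<in> sphere 0 1"
  shows "H_op (attenuated_ray_transform \<alpha> g) (x, \<xi>) = g (x, \<xi>) - \<alpha> * attenuated_ray_transform \<alpha> g (x, \<xi>)"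
proof -
  obtain g' where grad: "has_x_gradient g g'" and g': "\<And>q. continuous_on phase_space (g' q)"
    using g by auto
  have g: "continuous_on phase_space g" using g by simp
  obtain R where R: "K \<subseteq> cball 0 R"
    using compact_imp_bounded[OF K(2)] by (auto simp: bounded_iff subset_iff)
  have K': "x_supported K (g' q)" for q
    using x_supported_gradient[OF K(1) compact_imp_closed[OF K(2)] grad] .
  \<comment> \<open>The extra \<open>1\<close> puts the end point strictly outside the support, so that the boundary term there is
      zero; \<open>\<bar>R\<bar>\<close> keeps the interval nonempty in case \<open>R\<close> is negative (and \<open>K\<close> empty).\<close>
  define L where "L = norm x + \<bar>R\<bar> + 1"
  have L: "norm x + R \<le> L" "0 \<le> L" by (auto simp: L_def)
  let ?e = "\<lambda>s. exp (- \<alpha> * complex_of_real s)"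
  let ?h = "\<lambda>s. ?e s * g (x - s *\<^sub>R \<xi>, \<xi>)"
  let ?h' = "\<lambda>s. \<Sum>q\<in>UNIV. \<xi> $ q *\<^sub>R (?e s * g' q (x - s *\<^sub>R \<xi>, \<xi>))"
  have "(?h has_vector_derivative - \<alpha> * ?h s - ?h' s) (at s within {0..L})" for s
  proof -
    have "((\<lambda>s. g (x + s *\<^sub>R (- \<xi>), \<xi>)) has_vector_derivative
        (\<Sum>q\<in>UNIV. (- \<xi>) $ q *\<^sub>R g' q (x + s *\<^sub>R (- \<xi>), \<xi>))) (at s)"
      by (rule has_x_gradient_line[OF grad \<xi>])
    then have 1: "((\<lambda>s. g (x - s *\<^sub>R \<xi>, \<xi>)) has_vector_derivative
        - (\<Sum>q\<in>UNIV. \<xi> $ q *\<^sub>R g' q (x - s *\<^sub>R \<xi>, \<xi>))) (at s)"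
      by (simp add: sum_negf)
    have "((\<lambda>z. exp (- \<alpha> * z)) has_field_derivative - \<alpha> * ?e s) (at (complex_of_real s))"
      by (auto intro!: derivative_eq_intros)
    then have 2: "(?e has_vector_derivative - \<alpha> * ?e s) (at s)"
      by (rule has_vector_derivative_real_field)
    have "?h' s = ?e s * (\<Sum>q\<in>UNIV. \<xi> $ q *\<^sub>R g' q (x - s *\<^sub>R \<xi>, \<xi>))"
      by (simp add: sum_distrib_left)
    then have "- \<alpha> * ?h s - ?h' s = ?e s * - (\<Sum>q\<in>UNIV. \<xi> $ q *\<^sub>R g' q (x - s *\<^sub>R \<xi>, \<xi>))
        + - \<alpha> * ?e s * g (x - s *\<^sub>R \<xi>, \<xi>)"
      by (simp only:) simp
    then show ?thesis
      using has_vector_derivative_at_within[OF has_vector_derivative_mult[OF 2 1]] by (simp only:)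
  qed
  from fundamental_theorem_of_calculus[OF L(2) this]
  have "((\<lambda>s. - \<alpha> * ?h s - ?h' s) has_integral (?h L - ?h 0)) {0..L}" .
  moreover have "g (x - L *\<^sub>R \<xi>, \<xi>) = 0"
    by (rule x_supported_ray_exit[OF K(1) R \<xi>]) (simp add: L_def)
  ultimately have FTC: "((\<lambda>s. - \<alpha> * ?h s - ?h' s) has_integral - g (x, \<xi>)) {0..L}"
    by simp
  have ART: "((\<lambda>s. ?e s * k (x - s *\<^sub>R \<xi>, \<xi>)) has_integral attenuated_ray_transform \<alpha> k (x, \<xi>)) {0..L}"
    if "continuous_on phase_space k" "x_supported K k" for k
    unfolding attenuated_ray_transform_eq_integral[OF that R \<xi> L(1)]
    by (intro integrable_integral integrable_continuous_real continuous_intros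
        continuous_on_phase_compose[OF that(1)] \<xi>)
  have "((\<lambda>s. - \<alpha> * ?h s - ?h' s) has_integral (- \<alpha> * attenuated_ray_transform \<alpha> g (x, \<xi>)
      - (\<Sum>q\<in>UNIV. \<xi> $ q *\<^sub>R attenuated_ray_transform \<alpha> (g' q) (x, \<xi>)))) {0..L}"
    by (intro has_integral_diff has_integral_mult_right has_integral_sum has_integral_cmul ART g g' K K') simp
  with FTC have "- g (x, \<xi>) = - \<alpha> * attenuated_ray_transform \<alpha> g (x, \<xi>)
      - (\<Sum>q\<in>UNIV. \<xi> $ q *\<^sub>R attenuated_ray_transform \<alpha> (g' q) (x, \<xi>))"
    by (rule has_integral_unique)
  moreover have "H_op (attenuated_ray_transform \<alpha> g) (x, \<xi>) =
      (\<Sum>q\<in>UNIV. \<xi> $ q *\<^sub>R attenuated_ray_transform \<alpha> (g' q) (x, \<xi>))"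
    by (intro H_op_eq_gradient has_x_gradient_attenuated_ray_transform[OF g g' grad K] \<xi>)
  ultimately show ?thesis
    by (simp add: algebra_simps)
qed

section \<open>Iterated transport equation and the moment identity\<close>

lemma H_op_diff_mult:
  assumes "Ck_in_x 1 g" and "Ck_in_x 1 h" and "\<xi> \<in> sphere 0 1"
  shows "H_op (\<lambda>z. g z - c * h z) (x, \<xi>) = H_op g (x, \<xi>) - c * H_op h (x, \<xi>)"
proof -
  have "((\<lambda>t. k (x + t *\<^sub>R \<xi>, \<xi>)) has_vector_derivative H_op k (x, \<xi>)) (at 0)" if k: "Ck_in_x 1 k" for k
  proof -
    obtain k' where k': "has_x_gradient k k'" using k by auto
    show ?thesis
      using k' assms(3) unfolding H_op_eq_gradient[OF k' assms(3)] has_x_gradient_def by blast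
  qed
  from has_vector_derivative_diff[OF this[OF assms(1)]
      bounded_linear.has_vector_derivative[OF bounded_linear_mult_right this[OF assms(2)], of c]]
  show ?thesis
    unfolding H_op_def[of "\<lambda>z. g z - c * h z"] case_prod_conv by (rule vector_derivative_at)
qed

text \<open>Iterating the transport equation keeps it two-term, because \<open>H_op\<close> is linear and \<open>\<alpha>\<close> is constant.\<close>

lemma H_op_power_attenuated_ray_transform:
  assumes "Ck_in_x (Suc k) f" and "x_supported K f" and "compact K" and "\<xi> \<in> sphere 0 1"
  shows "(H_op ^^ Suc k) (attenuated_ray_transform \<alpha> f) (x, \<xi>) =
           (H_op ^^ k) f (x, \<xi>) - \<alpha> * (H_op ^^ k) (attenuated_ray_transform \<alpha> f) (x, \<xi>)"
  using assms(1)
proof (induction k arbitrary: x)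
  case 0
  then show ?case using H_op_attenuated_ray_transform[OF _ assms(2-4)] by simp
next
  case (Suc k)
  let ?u = "attenuated_ray_transform \<alpha> f"
  have "Ck_in_x (Suc k) f" using Suc.prems by (rule Ck_in_x_mono) simp
  note IH = Suc.IH[OF this]
  have "Ck_in_x (Suc (Suc k)) ?u"
    using Suc.prems assms by (intro Ck_in_x_attenuated_ray_transform)
  then have reg: "Ck_in_x 1 ((H_op ^^ k) f)" "Ck_in_x 1 ((H_op ^^ k) ?u)"
    using Suc.prems by (auto simp del: Ck_in_x.simps intro!: Ck_in_x_H_op_power elim!: Ck_in_x_mono)
  have "(H_op ^^ Suc (Suc k)) ?u (x, \<xi>) = H_op ((H_op ^^ Suc k) ?u) (x, \<xi>)"
    by simp
  also have "\<dots> = H_op (\<lambda>z. (H_op ^^ k) f z - \<alpha> * (H_op ^^ k) ?u z) (x, \<xi>)"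
    by (rule H_op_cong) (rule IH)
  also have "\<dots> = H_op ((H_op ^^ k) f) (x, \<xi>) - \<alpha> * H_op ((H_op ^^ k) ?u) (x, \<xi>)"
    by (rule H_op_diff_mult[OF reg assms(4)])
  finally show ?case by simp
qed

text \<open>Unfolding the two-term recursion produces a geometric progression in \<open>- \<alpha>\<close>.\<close>

lemma angular_moment_H_op_power_attenuated_ray_transform:
  assumes "Ck_in_x n f" and "x_supported K f" and "compact K" and "k \<le> n"
  shows "angular_moment p ((H_op ^^ k) (attenuated_ray_transform \<alpha> f)) I x =
           (\<Sum>j<k. (- 1) ^ j * \<alpha> ^ j * angular_moment p ((H_op ^^ (k - j - 1)) f) I x)
             + (- 1) ^ k * \<alpha> ^ k * angular_moment p (attenuated_ray_transform \<alpha> f) I x"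
  using assms(4)
proof (induction k)
  case (Suc k)
  let ?u = "attenuated_ray_transform \<alpha> f"
  let ?m = "\<lambda>\<xi>. complex_of_real (\<Prod>k<p. \<xi> $ (I ! k))"
  have f: "Ck_in_x (Suc k) f" using assms(1) Suc.prems by (rule Ck_in_x_mono)
  have "Ck_in_x (k + 0) f"
    using f by (rule Ck_in_x_mono) simp
  from Ck_in_x_H_op_power[OF this]
    Ck_in_x_H_op_power[OF Ck_in_x_attenuated_ray_transform[OF this assms(2,3), of \<alpha>]]
  have "Ck_in_x 0 ((H_op ^^ k) f)" "Ck_in_x 0 ((H_op ^^ k) ?u)"
    by blast+
  then have int: "integrable sphere_measure (\<lambda>\<xi>. (H_op ^^ k) f (x, \<xi>) * ?m \<xi>)"
    "integrable sphere_measure (\<lambda>\<xi>. (H_op ^^ k) ?u (x, \<xi>) * ?m \<xi>)"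
    by (simp_all add: integrable_sphere_measure continuous_on_moment_integrand del: of_real_prod)
  have "angular_moment p ((H_op ^^ Suc k) ?u) I x =
      (LINT \<xi>|sphere_measure. (H_op ^^ k) f (x, \<xi>) * ?m \<xi> - \<alpha> * ((H_op ^^ k) ?u (x, \<xi>) * ?m \<xi>))"
    unfolding angular_moment_def
    by (intro Bochner_Integration.integral_cong refl)
      (simp add: H_op_power_attenuated_ray_transform[OF f assms(2,3)] space_sphere_measure algebra_simps
        del: funpow.simps)
  also have "\<dots> = angular_moment p ((H_op ^^ k) f) I x - \<alpha> * angular_moment p ((H_op ^^ k) ?u) I x"
    unfolding angular_moment_def using int by simp
  also have "\<dots> = (\<Sum>j<Suc k. (- 1) ^ j * \<alpha> ^ j * angular_moment p ((H_op ^^ (Suc k - j - 1)) f) I x)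
             + (- 1) ^ Suc k * \<alpha> ^ Suc k * angular_moment p ?u I x"
    using Suc by (simp add: sum.lessThan_Suc_shift sum_distrib_left algebra_simps sum_negf del: sum.lessThan_Suc)
  finally show ?case .
qed simp

theorem corollary4p2:
  fixes n p :: nat and \<epsilon> \<kappa> :: real and \<alpha> :: complex
    and D :: "(real ^ 3) set" and f :: "(real ^ 3) \<times> (real ^ 3) \<Rightarrow> complex"
  assumes "n \<ge> 1"
    and "\<epsilon> \<ge> 0" and "\<alpha> = complex_of_real \<epsilon> + \<i> * complex_of_real \<kappa>"
    and "D \<noteq> {}" and "open D" and "bounded D" and "convex D" and "smooth_boundary D"
    and "Ck_on_submanifold n f (D \<times> sphere 0 1)"
    and "bounded (f ` (D \<times> sphere 0 1))"
    and "\<exists>K\<subseteq>D. compact K \<and> (\<forall>x \<xi>. x \<notin> K \<longrightarrow> \<xi> \<in> sphere 0 1 \<longrightarrow> f (x, \<xi>) = 0)"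
  shows "(\<forall>k<n. divergence_exists (p + n - Suc k)
            ((divergence ^^ k) (angular_moment (p + n) (attenuated_ray_transform \<alpha> f)))) \<and>
         (\<forall>I x. length I = p \<longrightarrow>
            (divergence ^^ n) (angular_moment (p + n) (attenuated_ray_transform \<alpha> f)) I x =
            (\<Sum>j=0..n - 1. (- 1) ^ j * \<alpha> ^ j * angular_moment p ((H_op ^^ (n - j - 1)) f) I x) +
            (- 1) ^ n * \<alpha> ^ n * angular_moment p (attenuated_ray_transform \<alpha> f) I x)"
proof -
  let ?u = "attenuated_ray_transform \<alpha> f"
  obtain K where K: "K \<subseteq> D" "compact K" "x_supported K f"
    using assms(11) unfolding x_supported_def by blast
  have f: "Ck_in_x n f"
    using Ck_on_submanifold_extend_by_zero[OF assms(5,9) compact_imp_closed[OF K(2)] K(1,3)]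
    by (rule Ck_on_submanifold_imp_Ck_in_x)
  have u: "Ck_in_x n ?u"
    by (rule Ck_in_x_attenuated_ray_transform[OF f K(3,2)])
  have "divergence_exists (p + n - Suc k) ((divergence ^^ k) (angular_moment (p + n) ?u))" if "k < n" for k
  proof -
    have "Suc (p + n - Suc k) + k = p + n" using that by simp
    then show ?thesis
      using divergence_exists_power_angular_moment[OF Ck_in_x_mono[OF u], of k "p + n - Suc k"] that by simp
  qed
  moreover have "(divergence ^^ n) (angular_moment (p + n) ?u) I x =
      (\<Sum>j=0..n - 1. (- 1) ^ j * \<alpha> ^ j * angular_moment p ((H_op ^^ (n - j - 1)) f) I x) +
            (- 1) ^ n * \<alpha> ^ n * angular_moment p ?u I x" if "length I = p" for I x
  proof -
    have "{..<n} = {0..n - 1}" using assms(1) by auto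
    then show ?thesis
      using divergence_power_angular_moment[OF u that] angular_moment_H_op_power_attenuated_ray_transform[OF f K(3,2) order_refl]
      by simp
  qed
  ultimately show ?thesis by blast
qed

end
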